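(* Let $\Gamma=([n],E_\Gamma)$ be a connected simple graph. There exists a Galois insertion $\mathrm{Cl}_\Gamma\hookrightarrow\mathrm{Gr}_\Gamma$ preserving skeleta. If $n>1$ and $j<\operatorname{rk}\mathrm{Flats}(\Gamma)=n-1$, then the skeleton $(\mathrm{Cl}_\Gamma)_j$ is the core of $(\mathrm{Gr}_\Gamma)_j$.
   Context: All posets are finite. A pair of monotone maps $f\colon S\rightleftarrows T\colon g$ is a Galois connection if $f(s)\leqslant t\Leftrightarrow s\leqslant g(t)$ for all $s\in S$, $t\in T$. A Galois insertion of $T$ in $S$ is an embedding $\iota\colon T\to S$ of $T$ as a subposet of $S$ together with a monotone map $\pi\colon S\to T$ such that $\pi\colon S\rightleftarrows T\colon\iota$ is a Galois connection. An upbeat (downbeat) is an element covered by exactly one element (covering exactly one element). A poset with no upbeats and no downbeats is a core; if $T$ is a core obtained from $S$ by consecutive removals of upbeats and downbeats, $T$ is called the core of $S$ (it is unique up to isomorphism). Clusterings. A clustering is an unordered partition $\mathcal C=\{V_1,\ldots,V_k\}$ of $V_\Gamma=[n]$ such that each induced subgraph $\Gamma_{V_i}$ is connected; clusterings are ordered by refinement ($\mathcal C'\le\mathcal C$ if every block of $\mathcal C'$ lies in a block of $\mathcal C$), with rank $n-|\mathcal C|$, and form the lattice $\mathrm{Flats}(\Gamma)$ of flats of the graphical matroid of $\Gamma$. Put $\Sigma_{\mathcal C}=\Sigma_{V_1}\times\cdots\times\Sigma_{V_k}$. Two bijections $p_1,p_2\colon V_\Gamma\to[n]$ are $\mathcal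 C$-equivalent if $p_1^{-1}\circ p_2\in\Sigma_{\mathcal C}$; an equivalence class is an assignment for $\mathcal C$. For $\mathcal C'\le\mathcal C$ there is a natural surjection $\mathrm{pr}_{\mathcal C'\le\mathcal C}$ from assignments for $\mathcal C'$ to assignments for $\mathcal C$. Cluster-permutohedron. $\mathrm{Cl}_\Gamma$ is the set of pairs $(\mathcal C,\mathcal A)$, $\mathcal A$ an assignment for the clustering $\mathcal C$, with $(\mathcal C',\mathcal A')\le(\mathcal C,\mathcal A)$ iff $\mathcal C'\le\mathcal C$ and $\mathrm{pr}_{\mathcal C'\le\mathcal C}(\mathcal A')=\mathcal A$; $\operatorname{rk}(\mathcal C,\mathcal A)=n-|\mathcal C|$. Graphicahedron. For $W\subseteq E_\Gamma$ let $\mathcal C(W)$ be the clustering given by the vertex sets of connected components of $([n],W)$. $\mathrm{Gr}_\Gamma$ is the set of pairs $(W,\mathcal A)$ with $W\subseteq E_\Gamma$ and $\mathcal A$ an assignment for $\mathcal C(W)$, with $(W',\mathcal A')\le(W,\mathcal A)$ iff $W'\subseteq W$ and $\mathrm{pr}_{\mathcal C(W')\le\mathcal C(W)}(\mathcal A')=\mathcal A$. Put $\mathrm{conn}((W,\mathcal A))=n-|\mathcal C(W)|$. Skeleta: $(\mathrm{Cl}_\Gamma)_j=\{s\mid\operatorname{rk}s\leqslant j\}$, $(\mathrm{Gr}_\Gamma)_j=\{s\mid\mathrm{conn}(s)\leqslant j\}$. The insertion preserves skeleta if both $\iota$ and $\pi$ send the $j$-skeleton into the $j$-skeleton for all $j$.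 *)

theory Defs
  imports "HOL-Algebra.Galois_Connection" "HOL-Combinatorics.Permutations"
begin

section \<open>Finite posets\<close>

definition galois_insertion :: "'t gorder \<Rightarrow> 's gorder \<Rightarrow> ('t \<Rightarrow> 's) \<Rightarrow> ('s \<Rightarrow> 't) \<Rightarrow> bool" where
  "galois_insertion T S \<iota> \<pi> \<longleftrightarrow>
     order_emb T S \<iota> \<and> isotone S T \<pi> \<and>
     galois_connection \<lparr>orderA = S, orderB = T, lower = \<pi>, upper = \<iota>\<rparr>"

definition order_iso :: "'a gorder \<Rightarrow> 'b gorder \<Rightarrow> bool" where
  "order_iso P Q \<longleftrightarrow> (\<exists>f. bij_betw f (carrier P) (carrier Q) \<and> order_emb P Q f)"

definition covered_by :: "'a gorder \<Rightarrow> 'a \<Rightarrow> 'a \<Rightarrow> bool" where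
  "covered_by P x y \<longleftrightarrow>
     x \<in> carrier P \<and> y \<in> carrier P \<and> x \<sqsubset>\<^bsub>P\<^esub> y \<and>
     \<not> (\<exists>z\<in>carrier P. x \<sqsubset>\<^bsub>P\<^esub> z \<and> z \<sqsubset>\<^bsub>P\<^esub> y)"

definition upbeat :: "'a gorder \<Rightarrow> 'a \<Rightarrow> bool" where
  "upbeat P x \<longleftrightarrow> x \<in> carrier P \<and> (\<exists>!y. covered_by P x y)"

definition downbeat :: "'a gorder \<Rightarrow> 'a \<Rightarrow> bool" where
  "downbeat P x \<longleftrightarrow> x \<in> carrier P \<and> (\<exists>!y. covered_by P y x)"

definition core_poset :: "'a gorder \<Rightarrow> bool" where
  "core_poset P \<longleftrightarrow>
     partial_order P \<and> finite (carrier P) \<and> (\<forall>x. \<not> upbeat P x) \<and> (\<forall>x. \<not> downbeat P x)"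

definition beat_removal :: "'a gorder \<Rightarrow> 'a gorder \<Rightarrow> bool" where
  "beat_removal P Q \<longleftrightarrow>
     (\<exists>x. (upbeat P x \<or> downbeat P x) \<and> Q = P\<lparr>carrier := carrier P - {x}\<rparr>)"

text \<open>The core is determined only up to isomorphism, so \<^term>\<open>T\<close> need not literally be a
  subposet of \<^term>\<open>S\<close>.\<close>

definition is_core_of :: "'a gorder \<Rightarrow> 'b gorder \<Rightarrow> bool" where
  "is_core_of T S \<longleftrightarrow> (\<exists>S'. beat_removal\<^sup>*\<^sup>* S S' \<and> core_poset S' \<and> order_iso T S')"

definition skeleton :: "'a gorder \<Rightarrow> ('a \<Rightarrow> nat) \<Rightarrow> nat \<Rightarrow> 'a gorder" where
  "skeleton P r j = P\<lparr>carrier := {s \<in> carrier P. r s \<le> j}\<rparr>"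

definition preserves_skeleta ::
  "'t gorder \<Rightarrow> ('t \<Rightarrow> nat) \<Rightarrow> 's gorder \<Rightarrow> ('s \<Rightarrow> nat) \<Rightarrow> ('t \<Rightarrow> 's) \<Rightarrow> ('s \<Rightarrow> 't) \<Rightarrow> bool"
where
  "preserves_skeleta T rT S rS \<iota> \<pi> \<longleftrightarrow>
     (\<forall>j. \<iota> ` carrier (skeleton T rT j) \<subseteq> carrier (skeleton S rS j) \<and>
          \<pi> ` carrier (skeleton S rS j) \<subseteq> carrier (skeleton T rT j))"


section \<open>Graphs on \<open>[n]\<close>\<close>

text \<open>The vertex set is \<^term>\<open>{1..n::nat}\<close> and edges are two-element sets of vertices.\<close>

definition simple_graph :: "nat \<Rightarrow> nat set set \<Rightarrow> bool" where
  "simple_graph n E \<longleftrightarrow> (\<forall>e\<in>E. e \<subseteq> {1..n} \<and> card e = 2)"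

definition adj :: "nat set set \<Rightarrow> (nat \<times> nat) set" where
  "adj F = {(u, v). {u, v} \<in> F}"

definition graph_connected :: "nat set \<Rightarrow> nat set set \<Rightarrow> bool" where
  "graph_connected V F \<longleftrightarrow> V \<noteq> {} \<and> (\<forall>u\<in>V. \<forall>v\<in>V. (u, v) \<in> (adj F)\<^sup>*)"

definition induced_edges :: "nat set set \<Rightarrow> nat set \<Rightarrow> nat set set" where
  "induced_edges E B = {e \<in> E. e \<subseteq> B}"

definition components :: "nat \<Rightarrow> nat set set \<Rightarrow> nat set set" where
  "components n W = {1..n} // {(u, v). u \<in> {1..n} \<and> v \<in> {1..n} \<and> (u, v) \<in> (adj W)\<^sup>*}"


section \<open>Clusterings and assignments\<close>

definition clustering :: "nat \<Rightarrow> nat set set \<Rightarrow> nat set set \<Rightarrow> bool" where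
  "clustering n E C \<longleftrightarrow>
     partition_on {1..n} C \<and> (\<forall>B\<in>C. graph_connected B (induced_edges E B))"

definition flats :: "nat \<Rightarrow> nat set set \<Rightarrow> nat set set gorder" where
  "flats n E = \<lparr>carrier = {C. clustering n E C}, eq = (=), le = refines {1..n}\<rparr>"

definition cluster_rank :: "nat \<Rightarrow> nat set set \<Rightarrow> nat" where
  "cluster_rank n C = n - card C"

definition flats_rank :: "nat \<Rightarrow> nat set set \<Rightarrow> nat" where
  "flats_rank n E = Max (cluster_rank n ` carrier (flats n E))"

text \<open>A bijection from the vertex set to \<open>[n]\<close> is represented by its unique extension to a
  permutation of \<^typ>\<open>nat\<close> that is the identity outside \<^term>\<open>{1..n::nat}\<close>.  The product of the
  symmetric groups of the blocks is the subgroup of permutations preserving every block.\<close>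

definition block_group :: "nat \<Rightarrow> nat set set \<Rightarrow> (nat \<Rightarrow> nat) set" where
  "block_group n C = {\<sigma>. \<sigma> permutes {1..n} \<and> (\<forall>B\<in>C. bij_betw \<sigma> B B)}"

definition assignment_rel :: "nat \<Rightarrow> nat set set \<Rightarrow> ((nat \<Rightarrow> nat) \<times> (nat \<Rightarrow> nat)) set" where
  "assignment_rel n C =
     {(p1, p2). p1 permutes {1..n} \<and> p2 permutes {1..n} \<and> inv p1 \<circ> p2 \<in> block_group n C}"

definition assignments :: "nat \<Rightarrow> nat set set \<Rightarrow> (nat \<Rightarrow> nat) set set" where
  "assignments n C = {p. p permutes {1..n}} // assignment_rel n C"

text \<open>The projection to the assignments for \<^term>\<open>C\<close> sends a class to its saturation under
  \<^term>\<open>C\<close>-equivalence; for an assignment for a refinement of \<^term>\<open>C\<close> this is the class of any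
  representative, see \<open>assignment_pr_class\<close>.\<close>

definition assignment_pr :: "nat \<Rightarrow> nat set set \<Rightarrow> (nat \<Rightarrow> nat) set \<Rightarrow> (nat \<Rightarrow> nat) set" where
  "assignment_pr n C A = assignment_rel n C `` A"

lemma bij_betw_inv_block:
  assumes "bij p" "bij_betw p B B"
  shows "bij_betw (inv p) B B"
  using assms by (metis bij_betw_def bij_def image_inv_f_f inj_imp_surj_inv inj_on_subset
      subset_UNIV surj_imp_inj_inv)

lemma equiv_assignment_rel: "equiv {p. p permutes {1..n}} (assignment_rel n C)"
proof (rule equivI)
  show "assignment_rel n C \<subseteq> {p. p permutes {1..n}} \<times> {p. p permutes {1..n}}"
    by (auto simp: assignment_rel_def)
  show "refl_on {p. p permutes {1..n}} (assignment_rel n C)"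
  proof (rule refl_onI)
    fix p assume "p \<in> {p. p permutes {1..n}}"
    then have "p permutes {1..n}" by simp
    moreover from this have "inv p \<circ> p = id" by (rule permutes_inv_o(2))
    ultimately show "(p, p) \<in> assignment_rel n C"
      by (simp add: assignment_rel_def block_group_def permutes_id)
  qed
  show "sym (assignment_rel n C)"
  proof (rule symI)
    fix p q assume "(p, q) \<in> assignment_rel n C"
    then have pq: "p permutes {1..n}" "q permutes {1..n}" "inv p \<circ> q \<in> block_group n C"
      by (auto simp: assignment_rel_def)
    have "inv (inv p \<circ> q) = inv q \<circ> p"
      using pq by (intro inv_unique_comp)
        (auto simp: fun_eq_iff permutes_inverses)
    moreover have "inv (inv p \<circ> q) \<in> block_group n C"
      using pq(3) unfolding block_group_def
      by (auto intro!: bij_betw_inv_block permutes_inv intro: permutes_bij)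
    ultimately show "(q, p) \<in> assignment_rel n C"
      using pq by (simp add: assignment_rel_def)
  qed
  show "trans (assignment_rel n C)"
  proof (rule transI)
    fix p q r assume "(p, q) \<in> assignment_rel n C" "(q, r) \<in> assignment_rel n C"
    then have pqr: "p permutes {1..n}" "q permutes {1..n}" "r permutes {1..n}"
        and g: "inv p \<circ> q \<in> block_group n C" "inv q \<circ> r \<in> block_group n C"
      by (auto simp: assignment_rel_def)
    have "inv p \<circ> r = (inv p \<circ> q) \<circ> (inv q \<circ> r)"
      using pqr by (auto simp: fun_eq_iff permutes_inverses)
    moreover have "(inv p \<circ> q) \<circ> (inv q \<circ> r) \<in> block_group n C"
      using g unfolding block_group_def
      by (auto intro: permutes_compose bij_betw_trans simp del: comp_assoc)
    ultimately show "(p, r) \<in> assignment_rel n C"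
      using pqr by (simp add: assignment_rel_def)
  qed
qed

lemma block_group_mono:
  assumes "refines {1..n} C' C"
  shows "block_group n C' \<subseteq> block_group n C"
proof
  fix \<sigma> assume s: "\<sigma> \<in> block_group n C'"
  have "\<sigma> ` B = B" if "B \<in> C" for B
  proof -
    have B: "B = \<Union>{X \<in> C'. X \<subseteq> B}"
    proof
      show "B \<subseteq> \<Union>{X \<in> C'. X \<subseteq> B}"
      proof
        fix x assume x: "x \<in> B"
        then have "x \<in> \<Union>C'"
          using assms that unfolding refines_def partition_on_def by blast
        then obtain X where X: "X \<in> C'" "x \<in> X" by blast
        then obtain Y where Y: "Y \<in> C" "X \<subseteq> Y"
          using assms by (auto simp: refines_def)
        then have "Y = B"
          using x X(2) that assms disjointD[of C Y B] by (auto simp: refines_def partition_on_def)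
        then show "x \<in> \<Union>{X \<in> C'. X \<subseteq> B}"
          using X Y by auto
      qed
    qed auto
    have "\<sigma> ` X = X" if "X \<in> C'" for X
      using s that by (auto simp: block_group_def bij_betw_def)
    then have "\<sigma> ` \<Union>{X \<in> C'. X \<subseteq> B} = \<Union>{X \<in> C'. X \<subseteq> B}"
      unfolding image_Union by (intro SUP_cong[of _ _ "\<lambda>X. \<sigma> ` X" "\<lambda>X. X", simplified]) auto
    then show ?thesis using B by simp
  qed
  then show "\<sigma> \<in> block_group n C"
    using s by (auto simp: block_group_def bij_betw_def intro: permutes_inj_on)
qed

lemma assignment_pr_class:
  assumes "refines {1..n} C' C" "p permutes {1..n}"
  shows "assignment_pr n C (assignment_rel n C' `` {p}) = assignment_rel n C `` {p}"
proof -
  have sub: "assignment_rel n C' \<subseteq> assignment_rel n C"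
    using block_group_mono[OF assms(1)] by (auto simp: assignment_rel_def)
  have "(p, p) \<in> assignment_rel n C'"
    using equiv_assignment_rel[of n C'] assms(2) by (auto simp: equiv_def refl_on_def)
  moreover have "trans (assignment_rel n C)"
    using equiv_assignment_rel[of n C] by (auto simp: equiv_def)
  ultimately show ?thesis
    using sub unfolding assignment_pr_def by (blast dest: transD)
qed


section \<open>Cluster-permutohedron and graphicahedron\<close>

definition cluster_permutohedron ::
  "nat \<Rightarrow> nat set set \<Rightarrow> (nat set set \<times> (nat \<Rightarrow> nat) set) gorder"
where
  "cluster_permutohedron n E =
     \<lparr>carrier = {(C, A). C \<in> carrier (flats n E) \<and> A \<in> assignments n C},
      eq = (=),
      le = (\<lambda>(C', A') (C, A). C' \<sqsubseteq>\<^bsub>flats n E\<^esub> C \<and> assignment_pr n C A' = A)\<rparr>"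

definition cl_rank :: "nat \<Rightarrow> nat set set \<times> (nat \<Rightarrow> nat) set \<Rightarrow> nat" where
  "cl_rank n = (\<lambda>(C, A). cluster_rank n C)"

definition graphicahedron ::
  "nat \<Rightarrow> nat set set \<Rightarrow> (nat set set \<times> (nat \<Rightarrow> nat) set) gorder"
where
  "graphicahedron n E =
     \<lparr>carrier = {(W, A). W \<subseteq> E \<and> A \<in> assignments n (components n W)},
      eq = (=),
      le = (\<lambda>(W', A') (W, A). W' \<subseteq> W \<and> assignment_pr n (components n W) A' = A)\<rparr>"

definition gr_conn :: "nat \<Rightarrow> nat set set \<times> (nat \<Rightarrow> nat) set \<Rightarrow> nat" where
  "gr_conn n = (\<lambda>(W, A). n - card (components n W))"

end

theory Submission
  imports Defs
begin

text \<open>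
  Sending an edge set \<open>W\<close> to the partition of the vertices into its connected components, and a
  clustering \<open>C\<close> to the set of all edges that lie inside a block of \<open>C\<close>, is a Galois connection:
  the components of \<open>W\<close> refine \<open>C\<close> exactly when \<open>W\<close> consists of edges inside blocks of \<open>C\<close>
  (\<open>components_refine_iff\<close>).  The blocks of a clustering are connected, so
  no clustering is lost on the way through edge sets (\<open>components_cluster_edges\<close>).  The order
  conditions on assignments refer to the components only, so keeping the assignment fixed lifts
  this connection to a Galois insertion of the cluster-permutohedron in the graphicahedron.  Both
  rank functions count components, so both maps preserve ranks and in particular skeleta, and the
  insertion restricts to every skeleton.

  For any Galois insertion in a finite poset, the composite \<open>\<iota> \<circ> \<pi>\<close> is a closure operator, and a
  maximal point among those that it moves is an upbeat: everything strictly above it is closed,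
  so its closure is its only cover.  Removing these points one after the other leaves the closed
  points, a copy of the smaller poset (\<open>galois_insertion_core\<close>).  Hence the smaller
  poset is the core of the larger one as soon as it is a core itself.

  It remains to exclude beat points in the proper skeleta of the cluster-permutohedron.  In a
  finite poset, a point is a downbeat if and only if there is a greatest point strictly below it,
  and dually for upbeats.  Below a given point, two different assignments for one clustering are
  incomparable, and an assignment for a clustering splits into at least two assignments for any
  strictly finer one (\<open>another_assignment\<close>); so no point strictly below is the greatest.  For
  upbeats, suppose that \<open>C'\<close> strictly coarsens \<open>C\<close> and, as happens below the top rank, has
  at least two blocks.  The graph is connected, so some edge joins two different blocks of \<open>C'\<close>, and merging the two blocks of \<open>C\<close> at its ends gives a
  clustering above \<open>C\<close>, of rank at most that of \<open>C'\<close>, that is not above \<open>C'\<close>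
  (\<open>merge_avoiding_coarsening\<close>).
\<close>

section \<open>Beat points and closure operators\<close>

lemma partial_order_subset:
  assumes "partial_order P" "A \<subseteq> carrier P"
  shows "partial_order (P\<lparr>carrier := A\<rparr>)"
proof -
  interpret partial_order P by fact
  interpret R: weak_partial_order "P\<lparr>carrier := A\<rparr>"
    by (rule weak_partial_order_subset[OF weak_partial_order_axioms assms(2)])
  show ?thesis
    by unfold_locales (simp add: eq_is_equal)
qed

text \<open>By finiteness every point strictly above \<open>x\<close> lies above some cover of \<open>x\<close>, so a unique cover
  is a least point of the strict up-set of \<open>x\<close>.  To refute this form it suffices to exhibit one
  point strictly above \<open>x\<close> that is not above a given candidate; the point need not be a cover.\<close>

lemma upbeat_iff:
  assumes "partial_order P" "finite (carrier P)"
  shows "upbeat P x \<longleftrightarrow> x \<in> carrier P \<and>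
    (\<exists>y\<in>carrier P. x \<sqsubset>\<^bsub>P\<^esub> y \<and> (\<forall>z\<in>carrier P. x \<sqsubset>\<^bsub>P\<^esub> z \<longrightarrow> y \<sqsubseteq>\<^bsub>P\<^esub> z))"
proof -
  interpret partial_order P by fact
  show ?thesis
  proof
    assume "upbeat P x"
    then obtain y where x: "x \<in> carrier P" and y: "covered_by P x y"
      and uniq: "\<And>y'. covered_by P x y' \<Longrightarrow> y' = y"
      by (auto simp: upbeat_def)
    have "y \<sqsubseteq>\<^bsub>P\<^esub> z" if z: "z \<in> carrier P" "x \<sqsubset>\<^bsub>P\<^esub> z" for z
    proof -
      let ?A = "{w \<in> carrier P. x \<sqsubset>\<^bsub>P\<^esub> w \<and> w \<sqsubseteq>\<^bsub>P\<^esub> z}"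
      have "\<exists>m\<in>?A. \<forall>w\<in>?A. w \<noteq> m \<longrightarrow> \<not> w \<sqsubset>\<^bsub>P\<^esub> m"
      proof (rule Finite_Set.bex_min_element)
        show "finite ?A" using assms(2) by simp
        show "asymp_on ?A (\<lambda>a b. a \<sqsubset>\<^bsub>P\<^esub> b)"
          by (auto intro!: asymp_onI dest: lless_antisym)
        show "transp_on ?A (\<lambda>a b. a \<sqsubset>\<^bsub>P\<^esub> b)"
          by (auto intro!: transp_onI intro: lless_trans)
        show "?A \<noteq> {}" using z by auto
      qed
      then obtain m where m: "m \<in> ?A" and min: "\<And>w. w \<in> ?A \<Longrightarrow> w \<noteq> m \<Longrightarrow> \<not> w \<sqsubset>\<^bsub>P\<^esub> m"
        by blast
      have "covered_by P x m"
        unfolding covered_by_def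
      proof (intro conjI notI)
        assume "\<exists>w\<in>carrier P. x \<sqsubset>\<^bsub>P\<^esub> w \<and> w \<sqsubset>\<^bsub>P\<^esub> m"
        then obtain w where w: "w \<in> carrier P" "x \<sqsubset>\<^bsub>P\<^esub> w" "w \<sqsubset>\<^bsub>P\<^esub> m" by blast
        then have "w \<sqsubseteq>\<^bsub>P\<^esub> z" using m z(1) by (auto simp: lless_eq intro: le_trans)
        with w min[of w] show False by (auto simp: lless_eq)
      qed (use x m in auto)
      then show ?thesis using uniq m by blast
    qed
    then show "x \<in> carrier P \<and> (\<exists>y\<in>carrier P. x \<sqsubset>\<^bsub>P\<^esub> y \<and>
        (\<forall>z\<in>carrier P. x \<sqsubset>\<^bsub>P\<^esub> z \<longrightarrow> y \<sqsubseteq>\<^bsub>P\<^esub> z))"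
      using x y by (auto simp: covered_by_def)
  next
    assume "x \<in> carrier P \<and> (\<exists>y\<in>carrier P. x \<sqsubset>\<^bsub>P\<^esub> y \<and>
        (\<forall>z\<in>carrier P. x \<sqsubset>\<^bsub>P\<^esub> z \<longrightarrow> y \<sqsubseteq>\<^bsub>P\<^esub> z))"
    then obtain y where y: "x \<in> carrier P" "y \<in> carrier P" "x \<sqsubset>\<^bsub>P\<^esub> y"
      and least: "\<And>z. z \<in> carrier P \<Longrightarrow> x \<sqsubset>\<^bsub>P\<^esub> z \<Longrightarrow> y \<sqsubseteq>\<^bsub>P\<^esub> z" by blast
    have "covered_by P x y"
      unfolding covered_by_def using y least le_antisym by (auto simp: lless_eq)
    moreover have "y' = y" if "covered_by P x y'" for y'
      using that least[of y'] y unfolding covered_by_def lless_eq by blast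
    ultimately show "upbeat P x" using y(1) by (auto simp: upbeat_def)
  qed
qed

lemma downbeat_iff:
  assumes "partial_order P" "finite (carrier P)"
  shows "downbeat P x \<longleftrightarrow> x \<in> carrier P \<and>
    (\<exists>y\<in>carrier P. y \<sqsubset>\<^bsub>P\<^esub> x \<and> (\<forall>z\<in>carrier P. z \<sqsubset>\<^bsub>P\<^esub> x \<longrightarrow> z \<sqsubseteq>\<^bsub>P\<^esub> y))"
proof -
  interpret partial_order P by fact
  have less: "a \<sqsubset>\<^bsub>inv_gorder P\<^esub> b \<longleftrightarrow> b \<sqsubset>\<^bsub>P\<^esub> a" for a b
    by (auto simp: lless_def eq_is_equal)
  have "downbeat P x \<longleftrightarrow> upbeat (inv_gorder P) x"
    unfolding downbeat_def upbeat_def covered_by_def less by (simp add: conj_commute conj_left_commute)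
  then show ?thesis
    using upbeat_iff[OF dual_order, of x] assms(2) by (simp add: less)
qed

lemma core_poset_order_iso:
  assumes "core_poset P" "order_iso P Q" "partial_order Q"
  shows "core_poset Q"
proof -
  obtain f where f: "bij_betw f (carrier P) (carrier Q)" "order_emb P Q f"
    using assms(2) by (auto simp: order_iso_def)
  have P: "partial_order P" "finite (carrier P)" using assms(1) by (auto simp: core_poset_def)
  have Q: "finite (carrier Q)" using P(2) f(1) bij_betw_finite by blast
  interpret P: partial_order P by fact
  interpret Q: partial_order Q by fact
  have im: "carrier Q = f ` carrier P" using f(1) by (simp add: bij_betw_def)
  have le: "f x \<sqsubseteq>\<^bsub>Q\<^esub> f y \<longleftrightarrow> x \<sqsubseteq>\<^bsub>P\<^esub> y" if "x \<in> carrier P" "y \<in> carrier P" for x y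
    using f(2) that by (auto simp: order_emb_def)
  have less: "f x \<sqsubset>\<^bsub>Q\<^esub> f y \<longleftrightarrow> x \<sqsubset>\<^bsub>P\<^esub> y" if "x \<in> carrier P" "y \<in> carrier P" for x y
    using le[OF that] f(1) that by (auto simp: P.lless_eq Q.lless_eq bij_betw_def inj_on_def)
  have "\<not> upbeat Q y" for y
  proof
    assume "upbeat Q y"
    then obtain x where "x \<in> carrier P" "y = f x" using im by (auto simp: upbeat_def)
    with \<open>upbeat Q y\<close> have "upbeat P x"
      unfolding upbeat_iff[OF assms(3) Q] upbeat_iff[OF P] im by (auto simp: le less)
    then show False using assms(1) by (simp add: core_poset_def)
  qed
  moreover have "\<not> downbeat Q y" for y
  proof
    assume "downbeat Q y"
    then obtain x where "x \<in> carrier P" "y = f x" using im by (auto simp: downbeat_def)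
    with \<open>downbeat Q y\<close> have "downbeat P x"
      unfolding downbeat_iff[OF assms(3) Q] downbeat_iff[OF P] im by (auto simp: le less)
    then show False using assms(1) by (simp add: core_poset_def)
  qed
  ultimately show ?thesis using assms(3) Q by (simp add: core_poset_def)
qed

text \<open>A closure operator \<open>c\<close> is removed from the top: if \<open>x\<close> is maximal among the points moved by
  \<open>c\<close>, then a point \<open>z\<close> strictly above \<open>x\<close> is closed, so \<open>c x \<sqsubseteq> c z = z\<close>.  Thus \<open>c x\<close> is the least
  point strictly above \<open>x\<close>, and \<open>x\<close> is an upbeat.  The image of \<open>c\<close> consists of closed points and
  so avoids \<open>x\<close>; hence \<open>c\<close> restricts to the poset without \<open>x\<close>, where it moves one point less.\<close>

lemma beat_removal_to_closed_points:
  assumes "partial_order S" "finite (carrier S)"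
    and "\<And>x. x \<in> carrier S \<Longrightarrow> c x \<in> carrier S"
    and "\<And>x. x \<in> carrier S \<Longrightarrow> x \<sqsubseteq>\<^bsub>S\<^esub> c x"
    and "\<And>x y. x \<in> carrier S \<Longrightarrow> y \<in> carrier S \<Longrightarrow> x \<sqsubseteq>\<^bsub>S\<^esub> y \<Longrightarrow> c x \<sqsubseteq>\<^bsub>S\<^esub> c y"
    and "\<And>x. x \<in> carrier S \<Longrightarrow> c (c x) = c x"
  shows "beat_removal\<^sup>*\<^sup>* S (S\<lparr>carrier := {x \<in> carrier S. c x = x}\<rparr>)"
  using assms
proof (induction "card {x \<in> carrier S. c x \<noteq> x}" arbitrary: S)
  case 0
  then have "{x \<in> carrier S. c x = x} = carrier S" by auto
  then show ?case by simp
next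
  case (Suc k)
  note po = Suc.prems(1) and fin = Suc.prems(2) and closed = Suc.prems(3)
    and extensive = Suc.prems(4) and mono = Suc.prems(5) and idem = Suc.prems(6)
  interpret partial_order S by (rule po)
  let ?N = "{x \<in> carrier S. c x \<noteq> x}"
  have "\<exists>m\<in>?N. \<forall>w\<in>?N. w \<noteq> m \<longrightarrow> \<not> m \<sqsubset>\<^bsub>S\<^esub> w"
  proof (rule Finite_Set.bex_max_element)
    show "finite ?N" using fin by simp
    show "asymp_on ?N (\<lambda>a b. a \<sqsubset>\<^bsub>S\<^esub> b)"
      by (auto intro!: asymp_onI dest: lless_antisym)
    show "transp_on ?N (\<lambda>a b. a \<sqsubset>\<^bsub>S\<^esub> b)"
      by (auto intro!: transp_onI intro: lless_trans)
    show "?N \<noteq> {}" using Suc.hyps(2) by (metis card.empty nat.distinct(1))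
  qed
  then obtain x where x: "x \<in> carrier S" "c x \<noteq> x"
    and max: "\<And>w. w \<in> carrier S \<Longrightarrow> x \<sqsubset>\<^bsub>S\<^esub> w \<Longrightarrow> c w = w"
    by (auto simp: lless_eq)
  have "upbeat S x"
    unfolding upbeat_iff[OF po fin]
  proof (intro conjI bexI ballI impI)
    show "x \<sqsubset>\<^bsub>S\<^esub> c x" using x extensive[of x] by (auto simp: lless_eq)
    fix z assume "z \<in> carrier S" "x \<sqsubset>\<^bsub>S\<^esub> z"
    then show "c x \<sqsubseteq>\<^bsub>S\<^esub> z" using mono[of x z] max[of z] x by (auto simp: lless_eq)
  qed (use x closed in auto)
  let ?S = "S\<lparr>carrier := carrier S - {x}\<rparr>"
  have step: "beat_removal S ?S"
    using \<open>upbeat S x\<close> by (auto simp: beat_removal_def)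
  have "{y \<in> carrier ?S. c y \<noteq> y} = ?N - {x}" by auto
  then have k: "k = card {y \<in> carrier ?S. c y \<noteq> y}"
    using Suc.hyps(2) x fin by (simp add: card_Diff_singleton_if)
  have "beat_removal\<^sup>*\<^sup>* ?S (?S\<lparr>carrier := {y \<in> carrier ?S. c y = y}\<rparr>)"
  proof (rule Suc.hyps(1)[OF k])
    show "partial_order ?S" by (rule partial_order_subset[OF po]) auto
    show "c y \<in> carrier ?S" if "y \<in> carrier ?S" for y
      using that closed[of y] idem[of y] x(2) by auto
  qed (use fin extensive mono idem in auto)
  moreover have "?S\<lparr>carrier := {y \<in> carrier ?S. c y = y}\<rparr> = S\<lparr>carrier := {y \<in> carrier S. c y = y}\<rparr>"
    using x(2) by (auto intro!: arg_cong[where f = "\<lambda>A. S\<lparr>carrier := A\<rparr>"])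
  ultimately show ?case using step by (simp add: converse_rtranclp_into_rtranclp)
qed

text \<open>The closed points of the closure operator \<open>\<iota> \<circ> \<pi>\<close> form the image of the embedding \<open>\<iota>\<close>.\<close>

lemma galois_insertion_core:
  assumes "galois_insertion T S \<iota> \<pi>" "finite (carrier S)" "core_poset T"
  shows "is_core_of T S"
proof -
  let ?G = "\<lparr>orderA = S, orderB = T, lower = \<pi>, upper = \<iota>\<rparr>"
  interpret galois_connection ?G
    rewrites "orderA ?G = S" and "orderB ?G = T" and "lower ?G = \<pi>" and "upper ?G = \<iota>"
    using assms(1) by (simp_all add: galois_insertion_def)
  interpret S: partial_order S by (rule is_order_A)
  interpret T: partial_order T by (rule is_order_B)
  have emb: "\<iota> x \<sqsubseteq>\<^bsub>S\<^esub> \<iota> y \<longleftrightarrow> x \<sqsubseteq>\<^bsub>T\<^esub> y" if "x \<in> carrier T" "y \<in> carrier T" for x y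
    using assms(1) that by (auto simp: galois_insertion_def order_emb_def)
  have inj: "inj_on \<iota> (carrier T)"
    by (metis T.le_antisym T.le_refl emb inj_onI)
  let ?F = "{x \<in> carrier S. \<iota> (\<pi> x) = x}"
  let ?S = "S\<lparr>carrier := ?F\<rparr>"
  have image: "\<iota> ` carrier T = ?F"
  proof
    show "?F \<subseteq> \<iota> ` carrier T" using lower_closed by (metis (mono_tags, lifting) image_eqI mem_Collect_eq subsetI)
  qed (use upper_comp upper_closed in auto)
  have po: "partial_order ?S" by (rule partial_order_subset[OF is_order_A]) auto
  have "beat_removal\<^sup>*\<^sup>* S ?S"
    using use_iso1[OF gf_iso] lower_closed upper_closed inflation upper_comp
    by (intro beat_removal_to_closed_points is_order_A assms(2)) auto
  moreover have iso: "order_iso T ?S"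
    unfolding order_iso_def order_emb_def
    using image inj emb partial_order.axioms(1)[OF po] T.weak_partial_order_axioms
    by (intro exI[of _ \<iota>]) (auto simp: bij_betw_def)
  moreover have "core_poset ?S"
    by (rule core_poset_order_iso[OF assms(3) iso po])
  ultimately show ?thesis by (auto simp: is_core_of_def)
qed

lemma galois_insertion_skeleton:
  assumes "galois_insertion T S \<iota> \<pi>" "preserves_skeleta T rT S rS \<iota> \<pi>"
  shows "galois_insertion (skeleton T rT j) (skeleton S rS j) \<iota> \<pi>"
proof -
  let ?G = "\<lparr>orderA = S, orderB = T, lower = \<pi>, upper = \<iota>\<rparr>"
  interpret galois_connection ?G
    rewrites "orderA ?G = S" and "orderB ?G = T" and "lower ?G = \<pi>" and "upper ?G = \<iota>"
    using assms(1) by (simp_all add: galois_insertion_def)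
  have S: "partial_order (skeleton S rS j)" and T: "partial_order (skeleton T rT j)"
    unfolding skeleton_def by (auto intro!: partial_order_subset is_order_A is_order_B)
  have \<iota>: "\<iota> x \<in> carrier (skeleton S rS j)" if "x \<in> carrier (skeleton T rT j)" for x
    using assms(2) that unfolding preserves_skeleta_def by blast
  have \<pi>: "\<pi> x \<in> carrier (skeleton T rT j)" if "x \<in> carrier (skeleton S rS j)" for x
    using assms(2) that unfolding preserves_skeleta_def by blast
  have "order_emb (skeleton T rT j) (skeleton S rS j) \<iota>"
    using assms(1) partial_order.axioms(1)[OF S] partial_order.axioms(1)[OF T]
    by (auto simp: galois_insertion_def order_emb_def skeleton_def)
  moreover have gc: "galois_connection
      \<lparr>orderA = skeleton S rS j, orderB = skeleton T rT j, lower = \<pi>, upper = \<iota>\<rparr>"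
    using S T \<iota> \<pi> galois_property
    by (intro galois_connection.intro connection.intro galois_connection_axioms.intro)
      (auto simp: skeleton_def)
  ultimately show ?thesis
    using galois_connection.lower_iso[OF gc] by (simp add: galois_insertion_def)
qed


section \<open>Refinements and assignments\<close>

text \<open>Two distinct blocks of the finer partition that get merged witness that a refinement is proper.
  This is the form in which properness is used, both for counting blocks and for finding a
  transposition that only the coarser partition allows.\<close>

lemma refines_neq_obtains:
  assumes "refines A P Q" "P \<noteq> Q"
  obtains B1 B2 X where "B1 \<in> P" "B2 \<in> P" "B1 \<noteq> B2" "X \<in> Q" "B1 \<subseteq> X" "B2 \<subseteq> X"
proof -
  have P: "partition_on A P" and Q: "partition_on A Q" using assms(1) by (auto simp: refines_def)
  have "\<not> refines A Q P" using assms refines_asym by blast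
  then obtain X where X: "X \<in> Q" "\<And>Y. Y \<in> P \<Longrightarrow> \<not> X \<subseteq> Y"
    using P Q by (auto simp: refines_def)
  have part: "partition_on X {p \<in> P. p \<subseteq> X}"
    by (rule refines_obtains_subset[OF assms(1) X(1)])
  have "X \<noteq> {}" using X(1) Q by (auto simp: partition_on_def)
  then obtain B1 where B1: "B1 \<in> P" "B1 \<subseteq> X" using part by (auto simp: partition_on_def)
  then obtain b where b: "b \<in> X" "b \<notin> B1" using X(2) by blast
  then obtain B2 where "B2 \<in> P" "B2 \<subseteq> X" "b \<in> B2"
    using partition_onD1[OF part] by blast
  with b B1 X(1) show ?thesis by (intro that[of B1 B2 X]) auto
qed

text \<open>Mapping a block to the block that contains it is onto the coarser partition, and not injective
  if the refinement is proper.\<close>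

lemma refines_neq_card:
  assumes "finite A" "refines A P Q" "P \<noteq> Q"
  shows "card Q < card P"
proof -
  have P: "partition_on A P" and Q: "partition_on A Q" using assms(2) by (auto simp: refines_def)
  have fin: "finite P" using assms(1) P by (rule finite_elements)
  obtain h where h: "\<And>B. B \<in> P \<Longrightarrow> h B \<in> Q \<and> B \<subseteq> h B"
    using assms(2) unfolding refines_def by metis
  have h_eq: "h B = X" if "B \<in> P" "X \<in> Q" "B \<subseteq> X" for B X
  proof -
    have "B \<noteq> {}" using that(1) P by (auto simp: partition_on_def)
    then show ?thesis using h[OF that(1)] that disjointD[OF partition_onD2[OF Q], of "h B" X] by blast
  qed
  have "Q \<subseteq> h ` P"
  proof
    fix X assume X: "X \<in> Q"
    then have "X \<noteq> {}" using Q by (auto simp: partition_on_def)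
    then obtain B where "B \<in> P" "B \<subseteq> X"
      using refines_obtains_subset[OF assms(2) X] by (auto simp: partition_on_def)
    then show "X \<in> h ` P" using h_eq X by blast
  qed
  then have img: "h ` P = Q" using h by auto
  obtain B1 B2 X where "B1 \<in> P" "B2 \<in> P" "B1 \<noteq> B2" "X \<in> Q" "B1 \<subseteq> X" "B2 \<subseteq> X"
    using refines_neq_obtains[OF assms(2,3)] .
  then have "\<not> inj_on h P" using h_eq by (metis inj_onD)
  then show ?thesis
    using fin img card_image_le[OF fin, of h] eq_card_imp_inj_on[OF fin, of h] by force
qed

lemma assignments_iff:
  "A \<in> assignments n C \<longleftrightarrow> (\<exists>p. p permutes {1..n} \<and> A = assignment_rel n C `` {p})"
  by (auto simp: assignments_def quotient_def)

lemma assignment_pr_in: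
  assumes "refines {1..n} C' C" "A \<in> assignments n C'"
  shows "assignment_pr n C A \<in> assignments n C"
  using assms assignment_pr_class by (auto simp: assignments_iff)

lemma assignment_pr_id:
  assumes "partition_on {1..n} C" "A \<in> assignments n C"
  shows "assignment_pr n C A = A"
  using assms assignment_pr_class[OF refines_refl] by (auto simp: assignments_iff)

lemma assignment_pr_comp:
  assumes "refines {1..n} C1 C2" "refines {1..n} C2 C3" "A \<in> assignments n C1"
  shows "assignment_pr n C3 (assignment_pr n C2 A) = assignment_pr n C3 A"
proof -
  obtain p where p: "p permutes {1..n}" "A = assignment_rel n C1 `` {p}"
    using assms(3) by (auto simp: assignments_iff)
  then show ?thesis
    using assms refines_trans[OF assms(1,2)] by (simp add: assignment_pr_class)
qed

lemma finite_assignments: "finite (assignments n C)"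
proof (rule finite_subset)
  show "assignments n C \<subseteq> Pow {p. p permutes {1..n}}"
    by (auto simp: assignments_iff assignment_rel_def)
qed (simp add: finite_permutations)

text \<open>Take points \<open>a\<close> and \<open>b\<close> in different blocks of \<open>C'\<close> but in the same block of \<open>C\<close>.  Composing
  a representative with the transposition of \<open>a\<close> and \<open>b\<close> changes its class for \<open>C'\<close> but not its
  class for \<open>C\<close>.\<close>

lemma another_assignment:
  assumes "refines {1..n} C' C" "C' \<noteq> C" "A \<in> assignments n C'"
  obtains A' where "A' \<in> assignments n C'" "A' \<noteq> A" "assignment_pr n C A' = assignment_pr n C A"
proof -
  have C': "partition_on {1..n} C'" and C: "partition_on {1..n} C"
    using assms(1) by (auto simp: refines_def)
  obtain p where p: "p permutes {1..n}" "A = assignment_rel n C' `` {p}"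
    using assms(3) by (auto simp: assignments_iff)
  obtain B1 B2 X where B: "B1 \<in> C'" "B2 \<in> C'" "B1 \<noteq> B2" "X \<in> C" "B1 \<subseteq> X" "B2 \<subseteq> X"
    using refines_neq_obtains[OF assms(1,2)] .
  obtain a b where ab: "a \<in> B1" "b \<in> B2" using B C' by (metis partition_onD3 ex_in_conv)
  have b: "b \<notin> B1" using B ab disjointD[OF partition_onD2[OF C'], of B1 B2] by blast
  have X: "a \<in> X" "b \<in> X" "X \<subseteq> {1..n}" using ab B partition_onD1[OF C] by auto
  define \<tau> where "\<tau> = transpose a b"
  have \<tau>: "\<tau> permutes {1..n}" unfolding \<tau>_def using X by (intro permutes_swap_id) auto
  have p': "p \<circ> \<tau> permutes {1..n}" using permutes_compose[OF \<tau> p(1)] .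
  have inv: "inv p \<circ> (p \<circ> \<tau>) = \<tau>"
    using permutes_inv_o(2)[OF p(1)] by (simp add: o_assoc)
  have "bij_betw \<tau> Y Y" if "Y \<in> C" for Y
  proof (cases "Y = X")
    case True
    then show ?thesis using X by (auto simp: \<tau>_def bij_betw_def inj_on_def transpose_def image_iff)
  next
    case False
    then have "a \<notin> Y" "b \<notin> Y"
      using X B(4) that disjointD[OF partition_onD2[OF C], of Y X] by auto
    then show ?thesis by (auto simp: \<tau>_def bij_betw_def inj_on_def transpose_def image_iff)
  qed
  then have in_C: "(p, p \<circ> \<tau>) \<in> assignment_rel n C"
    using p p' \<tau> inv by (auto simp: assignment_rel_def block_group_def)
  have "\<tau> a \<notin> B1" using b by (simp add: \<tau>_def)
  then have "\<not> bij_betw \<tau> B1 B1" using ab(1) by (auto simp: bij_betw_def)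
  then have not_C': "(p, p \<circ> \<tau>) \<notin> assignment_rel n C'"
    using B(1) inv by (auto simp: assignment_rel_def block_group_def)
  let ?A' = "assignment_rel n C' `` {p \<circ> \<tau>}"
  show ?thesis
  proof (rule that[of ?A'])
    show "?A' \<in> assignments n C'" using p' by (auto simp: assignments_iff)
    show "?A' \<noteq> A"
      using not_C' p p' eq_equiv_class_iff[OF equiv_assignment_rel, of p n "p \<circ> \<tau>" C'] by auto
    show "assignment_pr n C ?A' = assignment_pr n C A"
      using in_C p p' assignment_pr_class[OF assms(1)] equiv_class_eq[OF equiv_assignment_rel in_C]
      by simp
  qed
qed

text \<open>The common shape of the cluster-permutohedron and the graphicahedron: points of a poset \<open>L\<close>
  that determine partitions by a monotone map \<open>f\<close>, together with an assignment for that partition.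
  For the former, \<open>L\<close> is the poset of clusterings and \<open>f\<close> the identity; for the latter, \<open>L\<close> is the
  poset of edge sets and \<open>f\<close> sends an edge set to its components.\<close>

definition with_assignments ::
  "nat \<Rightarrow> 'a gorder \<Rightarrow> ('a \<Rightarrow> nat set set) \<Rightarrow> ('a \<times> (nat \<Rightarrow> nat) set) gorder" where
  "with_assignments n L f =
     \<lparr>carrier = {(x, A). x \<in> carrier L \<and> A \<in> assignments n (f x)}, eq = (=),
      le = (\<lambda>(x', A') (x, A). x' \<sqsubseteq>\<^bsub>L\<^esub> x \<and> assignment_pr n (f x) A' = A)\<rparr>"

lemma partial_order_with_assignments:
  assumes "partial_order L"
    and mono: "\<And>x y. x \<in> carrier L \<Longrightarrow> y \<in> carrier L \<Longrightarrow> x \<sqsubseteq>\<^bsub>L\<^esub> y \<Longrightarrow> refines {1..n} (f x) (f y)"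
  shows "partial_order (with_assignments n L f)"
proof -
  interpret partial_order L by fact
  have part: "partition_on {1..n} (f x)" if "x \<in> carrier L" for x
    using mono[OF that that] that by (auto simp: refines_def)
  show ?thesis
  proof
    fix a b assume "a \<sqsubseteq>\<^bsub>with_assignments n L f\<^esub> b" "b \<sqsubseteq>\<^bsub>with_assignments n L f\<^esub> a"
      "a \<in> carrier (with_assignments n L f)" "b \<in> carrier (with_assignments n L f)"
    then have "fst a = fst b" "assignment_pr n (f (fst b)) (snd a) = snd b"
      "fst a \<in> carrier L" "snd a \<in> assignments n (f (fst a))"
      by (auto simp: with_assignments_def)
    then show "a .=\<^bsub>with_assignments n L f\<^esub> b"
      using assignment_pr_id[OF part] by (auto simp: with_assignments_def prod_eq_iff)
  next
    fix a b c assume abc: "a \<sqsubseteq>\<^bsub>with_assignments n L f\<^esub> b" "b \<sqsubseteq>\<^bsub>with_assignments n L f\<^esub> c"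
      "a \<in> carrier (with_assignments n L f)" "b \<in> carrier (with_assignments n L f)"
      "c \<in> carrier (with_assignments n L f)"
    have "assignment_pr n (f (fst c)) (snd a) = snd c"
      using assignment_pr_comp[OF mono mono, of "fst a" "fst b" "fst c" "snd a"] abc
      by (auto simp: with_assignments_def)
    then show "a \<sqsubseteq>\<^bsub>with_assignments n L f\<^esub> c"
      using abc le_trans by (auto simp: with_assignments_def)
  qed (auto simp: with_assignments_def assignment_pr_id[OF part])
qed

lemma finite_with_assignments:
  assumes "finite (carrier L)"
  shows "finite (carrier (with_assignments n L f))"
proof -
  have "carrier (with_assignments n L f) = (SIGMA x:carrier L. assignments n (f x))"
    by (auto simp: with_assignments_def)
  then show ?thesis using assms finite_assignments by simp
qed


section \<open>Edge sets and clusterings\<close>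

definition cluster_edges :: "nat set set \<Rightarrow> nat set set \<Rightarrow> nat set set" where
  "cluster_edges E C = {e \<in> E. \<exists>B\<in>C. e \<subseteq> B}"

lemma adj_rtrancl_mono: "F \<subseteq> F' \<Longrightarrow> (u, v) \<in> (adj F)\<^sup>* \<Longrightarrow> (u, v) \<in> (adj F')\<^sup>*"
  by (rule subsetD[OF rtrancl_mono]) (auto simp: adj_def)

lemma adj_rtrancl_sym: "(u, v) \<in> (adj F)\<^sup>* \<Longrightarrow> (v, u) \<in> (adj F)\<^sup>*"
proof -
  have "sym (adj F)" by (auto simp: sym_def adj_def insert_commute)
  then show "(u, v) \<in> (adj F)\<^sup>* \<Longrightarrow> (v, u) \<in> (adj F)\<^sup>*"
    using sym_rtrancl symD by metis
qed

lemma equiv_reachable: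
  "equiv {1..n} {(u, v). u \<in> {1..n} \<and> v \<in> {1..n} \<and> (u, v) \<in> (adj W)\<^sup>*}"
  by (rule equivI) (auto simp: refl_on_def sym_def trans_def intro: adj_rtrancl_sym)

lemma partition_components: "partition_on {1..n} (components n W)"
  unfolding components_def by (rule partition_on_quotient[OF equiv_reachable])

lemma components_iff:
  "X \<in> components n W \<longleftrightarrow> (\<exists>x\<in>{1..n}. X = {v \<in> {1..n}. (x, v) \<in> (adj W)\<^sup>*})"
  unfolding components_def quotient_def by auto

lemma edge_obtains:
  assumes "simple_graph n E" "e \<in> E"
  obtains u v where "e = {u, v}" "u \<in> {1..n}" "v \<in> {1..n}"
  using assms unfolding simple_graph_def by (metis card_2_iff insert_subset)

text \<open>The Galois connection between edge sets and clusterings.  A path whose edges stay inside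
  blocks of \<open>C\<close> cannot leave the block in which it starts; conversely, the ends of an edge of \<open>W\<close>
  lie in one component of \<open>W\<close>.\<close>

lemma components_refine_iff:
  assumes "simple_graph n E" "W \<subseteq> E" "partition_on {1..n} C"
  shows "refines {1..n} (components n W) C \<longleftrightarrow> W \<subseteq> cluster_edges E C"
proof
  assume ref: "refines {1..n} (components n W) C"
  show "W \<subseteq> cluster_edges E C"
  proof
    fix e assume e: "e \<in> W"
    then obtain u v where uv: "e = {u, v}" "u \<in> {1..n}" "v \<in> {1..n}"
      using edge_obtains[OF assms(1)] assms(2) by blast
    let ?X = "{w \<in> {1..n}. (u, w) \<in> (adj W)\<^sup>*}"
    have "?X \<in> components n W" using uv by (auto simp: components_iff)
    then obtain B where "B \<in> C" "?X \<subseteq> B" using ref by (auto simp: refines_def)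
    moreover have "e \<subseteq> ?X" using e uv by (auto simp: adj_def)
    ultimately show "e \<in> cluster_edges E C"
      using e assms(2) by (auto simp: cluster_edges_def)
  qed
next
  assume sub: "W \<subseteq> cluster_edges E C"
  have "\<exists>B\<in>C. X \<subseteq> B" if "X \<in> components n W" for X
  proof -
    obtain x where x: "x \<in> {1..n}" "X = {v \<in> {1..n}. (x, v) \<in> (adj W)\<^sup>*}"
      using \<open>X \<in> components n W\<close> by (auto simp: components_iff)
    then obtain B where B: "B \<in> C" "x \<in> B" using partition_onD1[OF assms(3)] by blast
    have "v \<in> B" if "(x, v) \<in> (adj W)\<^sup>*" for v
      using that
    proof induction
      case (step y z)
      then obtain B' where B': "B' \<in> C" "{y, z} \<subseteq> B'"
        using sub by (auto simp: adj_def cluster_edges_def)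
      then have "B' = B"
        using step.IH B(1) disjointD[OF partition_onD2[OF assms(3)], of B' B] by blast
      then show ?case using B' by blast
    qed (rule B(2))
    then show ?thesis using B x by blast
  qed
  then show "refines {1..n} (components n W) C"
    using partition_components assms(3) by (auto simp: refines_def)
qed

text \<open>This is where connectedness of the blocks enters: any two points of a block are joined by a path
  inside the block, and such a path uses only edges inside blocks.\<close>

lemma clustering_refines_components_cluster_edges:
  assumes "clustering n E C"
  shows "refines {1..n} C (components n (cluster_edges E C))"
proof -
  have C: "partition_on {1..n} C" using assms by (simp add: clustering_def)
  have "\<exists>X\<in>components n (cluster_edges E C). B \<subseteq> X" if B: "B \<in> C" for B
  proof -
    have conn: "graph_connected B (induced_edges E B)"
      using assms B by (simp add: clustering_def)
    then obtain b where b: "b \<in> B" by (auto simp: graph_connected_def)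
    have sub: "induced_edges E B \<subseteq> cluster_edges E C"
      using B by (auto simp: induced_edges_def cluster_edges_def)
    have B_sub: "B \<subseteq> {1..n}" using B partition_onD1[OF C] by auto
    have "{v \<in> {1..n}. (b, v) \<in> (adj (cluster_edges E C))\<^sup>*} \<in> components n (cluster_edges E C)"
      unfolding components_iff by (rule bexI[of _ b, OF refl]) (use b B_sub in auto)
    moreover have "B \<subseteq> {v \<in> {1..n}. (b, v) \<in> (adj (cluster_edges E C))\<^sup>*}"
      using conn b B_sub by (auto simp: graph_connected_def intro: adj_rtrancl_mono[OF sub])
    ultimately show ?thesis by (rule bexI[rotated])
  qed
  then show ?thesis using C partition_components by (auto simp: refines_def)
qed

lemma components_cluster_edges:
  assumes "simple_graph n E" "clustering n E C"
  shows "components n (cluster_edges E C) = C"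
proof (rule refines_asym)
  show "refines {1..n} (components n (cluster_edges E C)) C"
    using assms
    by (subst components_refine_iff[of n E]) (auto simp: clustering_def cluster_edges_def)
qed (rule clustering_refines_components_cluster_edges[OF assms(2)])

lemma clustering_components:
  assumes "simple_graph n E" "W \<subseteq> E"
  shows "clustering n E (components n W)"
  unfolding clustering_def
proof (intro conjI ballI partition_components)
  fix X assume "X \<in> components n W"
  then obtain x where x: "x \<in> {1..n}" "X = {v \<in> {1..n}. (x, v) \<in> (adj W)\<^sup>*}"
    by (auto simp: components_iff)
  \<comment> \<open>A path that starts in a component never leaves it, so it is a path in the induced subgraph.\<close>
  have path: "v \<in> X \<and> (u, v) \<in> (adj (induced_edges E X))\<^sup>*"
    if "(u, v) \<in> (adj W)\<^sup>*" "u \<in> X" for u v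
    using that
  proof induction
    case (step y z)
    have y: "y \<in> X" "(u, y) \<in> (adj (induced_edges E X))\<^sup>*"
      using step.IH[OF step.prems] by simp_all
    have yz: "{y, z} \<in> W" using step.hyps(2) by (simp add: adj_def)
    then have "{y, z} \<subseteq> {1..n}" using assms by (simp only: simple_graph_def subsetD)
    then have "z \<in> {1..n}" by simp
    moreover have "(x, z) \<in> (adj W)\<^sup>*"
      using y(1) step.hyps(2) unfolding x(2) by (auto intro: rtrancl_into_rtrancl)
    ultimately have z: "z \<in> X" unfolding x(2) by simp
    have "(y, z) \<in> adj (induced_edges E X)"
      using yz y(1) z assms(2) unfolding adj_def induced_edges_def by blast
    then show ?case using z rtrancl_into_rtrancl[OF y(2)] by simp
  qed simp
  show "graph_connected X (induced_edges E X)"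
    unfolding graph_connected_def
  proof (intro conjI ballI)
    show "X \<noteq> {}" using x by auto
    fix u v assume "u \<in> X" "v \<in> X"
    then have "(x, u) \<in> (adj W)\<^sup>*" "(x, v) \<in> (adj W)\<^sup>*" using x(2) by simp_all
    then have "(u, v) \<in> (adj W)\<^sup>*" using adj_rtrancl_sym rtrancl_trans by metis
    then show "(u, v) \<in> (adj (induced_edges E X))\<^sup>*" using path[OF _ \<open>u \<in> X\<close>] by simp
  qed
qed

lemma components_mono:
  assumes "simple_graph n E" "W' \<subseteq> W" "W \<subseteq> E"
  shows "refines {1..n} (components n W') (components n W)"
proof -
  have "W \<subseteq> cluster_edges E (components n W)"
    using components_refine_iff[OF assms(1,3) partition_components]
      refines_refl[OF partition_components] by blast
  then show ?thesis
    using components_refine_iff[OF assms(1) _ partition_components, of W'] assms(2,3) by blast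
qed

lemma edge_leaving_block:
  assumes "graph_connected {1..n} E" "B \<subseteq> {1..n}" "B \<noteq> {}" "B \<noteq> {1..n}"
  obtains u v where "{u, v} \<in> E" "u \<in> B" "v \<notin> B"
proof -
  obtain a b where ab: "a \<in> B" "b \<in> {1..n}" "b \<notin> B" using assms(2-4) by blast
  have "\<exists>u v. {u, v} \<in> E \<and> u \<in> B \<and> v \<notin> B"
  proof (rule ccontr)
    assume none: "\<nexists>u v. {u, v} \<in> E \<and> u \<in> B \<and> v \<notin> B"
    have "v \<in> B" if "(a, v) \<in> (adj E)\<^sup>*" for v
      using that by induction (use ab none in \<open>auto simp: adj_def\<close>)
    moreover have "(a, b) \<in> (adj E)\<^sup>*"
      using assms(1) subsetD[OF assms(2) ab(1)] ab(2) unfolding graph_connected_def by blast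
    ultimately show False using ab(3) by blast
  qed
  then show ?thesis using that by blast
qed

lemma clustering_merge:
  assumes C: "clustering n E C" and B: "B1 \<in> C" "B2 \<in> C" "B1 \<noteq> B2"
    and uv: "{u, v} \<in> E" "u \<in> B1" "v \<in> B2"
  defines "D \<equiv> insert (B1 \<union> B2) (C - {B1, B2})"
  shows "clustering n E D" "refines {1..n} C D" "Suc (card D) = card C"
proof -
  have part: "partition_on {1..n} C" using C by (simp add: clustering_def)
  have fin: "finite C" using part by (rule finite_elements[rotated]) simp
  have disj: "X \<inter> Y = {}" if "X \<in> C" "Y \<in> C" "X \<noteq> Y" for X Y
    using disjointD[OF partition_onD2[OF part]] that by blast
  have "disjoint (C - {B1, B2})" using partition_onD2[OF part] by (rule pairwise_subset) auto
  moreover have "disjnt (B1 \<union> B2) Y" if "Y \<in> C - {B1, B2}" for Y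
    using disj[of B1 Y] disj[of B2 Y] B that by (auto simp: disjnt_def)
  ultimately have "disjoint D" unfolding D_def pairwise_insert by (auto simp: disjnt_sym)
  moreover have "\<Union>D = {1..n}" using partition_onD1[OF part] B unfolding D_def by blast
  moreover have "{} \<notin> D" using partition_onD3[OF part] B unfolding D_def by auto
  ultimately have partD: "partition_on {1..n} D" by (simp add: partition_on_def)
  have "graph_connected (B1 \<union> B2) (induced_edges E (B1 \<union> B2))"
  proof -
    let ?R = "(adj (induced_edges E (B1 \<union> B2)))\<^sup>*"
    have within: "(a, b) \<in> ?R" if "X \<in> {B1, B2}" "a \<in> X" "b \<in> X" for X a b
    proof (rule adj_rtrancl_mono)
      show "induced_edges E X \<subseteq> induced_edges E (B1 \<union> B2)"
        using that(1) by (auto simp: induced_edges_def)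
      have "graph_connected X (induced_edges E X)"
        using C B that(1) by (auto simp: clustering_def)
      then show "(a, b) \<in> (adj (induced_edges E X))\<^sup>*"
        using that(2,3) by (simp add: graph_connected_def)
    qed
    have "(u, v) \<in> ?R" using uv by (auto simp: adj_def induced_edges_def)
    then have to_v: "(a, v) \<in> ?R" if "a \<in> B1 \<union> B2" for a
      using that within[of B1 a u] within[of B2 a v] uv by (auto intro: rtrancl_trans)
    have "(a, b) \<in> ?R" if "a \<in> B1 \<union> B2" "b \<in> B1 \<union> B2" for a b
      using to_v[OF that(1)] adj_rtrancl_sym[OF to_v[OF that(2)]] by (rule rtrancl_trans)
    then show ?thesis using uv by (auto simp: graph_connected_def)
  qed
  then show "clustering n E D" using C partD by (auto simp: clustering_def D_def)
  have "\<exists>Y\<in>D. X \<subseteq> Y" if "X \<in> C" for X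
    using that by (cases "X \<in> {B1, B2}") (auto simp: D_def)
  then show "refines {1..n} C D" using part partD by (simp add: refines_def)
  have "B1 \<union> B2 \<notin> C - {B1, B2}"
    using disj[of B1 "B1 \<union> B2"] B(1) uv(2) by auto
  moreover have "card C \<ge> 2" using card_mono[OF fin, of "{B1, B2}"] B by simp
  ultimately show "Suc (card D) = card C"
    using fin B by (simp add: D_def card_Diff_subset)
qed

text \<open>An edge between two blocks of \<open>C'\<close> has its ends in distinct blocks \<open>B1\<close> and \<open>B2\<close> of \<open>C\<close>.  Let
  \<open>D\<close> be \<open>C\<close> with these two merged.  Since \<open>C'\<close> merges some two blocks of \<open>C\<close>, and
  \<open>B1\<close> and \<open>B2\<close> are the only two that \<open>D\<close> merges, \<open>C'\<close> could refine \<open>D\<close> only by merging \<open>B1\<close> and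
  \<open>B2\<close> as well; but the edge was chosen to join different blocks of \<open>C'\<close>.\<close>

lemma merge_avoiding_coarsening:
  assumes simple: "simple_graph n E" and graph: "graph_connected {1..n} E"
    and C: "clustering n E C" and C': "refines {1..n} C C'" "C \<noteq> C'" "card C' > 1"
  obtains D where "clustering n E D" "refines {1..n} C D" "Suc (card D) = card C"
    "\<not> refines {1..n} C' D"
proof -
  have part: "partition_on {1..n} C" and part': "partition_on {1..n} C'"
    using C' by (auto simp: refines_def)
  have disj: "X = Y" if "X \<in> C" "Y \<in> C" "z \<in> X" "z \<in> Y" for X Y z
    using disjointD[OF partition_onD2[OF part], of X Y] that by blast
  have disj': "X = Y" if "X \<in> C'" "Y \<in> C'" "z \<in> X" "z \<in> Y" for X Y z
    using disjointD[OF partition_onD2[OF part'], of X Y] that by blast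
  have "finite C'" using C'(3) card.infinite by force
  then obtain B B' where B: "B \<in> C'" and B': "B' \<in> C'" "B' \<noteq> B"
    using C'(3) card_le_Suc0_iff_eq[of C'] by force
  have subset: "B \<subseteq> {1..n}" "B' \<subseteq> {1..n}" and nonempty: "B \<noteq> {}" "B' \<noteq> {}"
    using B B' partition_onD1[OF part'] partition_onD3[OF part'] by auto
  have "B \<noteq> {1..n}" using disj'[OF B B'(1)] B'(2) subset(2) nonempty(2) by blast
  then obtain u v where uv: "{u, v} \<in> E" "u \<in> B" "v \<notin> B"
    using edge_leaving_block[OF graph subset(1) nonempty(1)] by blast
  have "{u, v} \<subseteq> {1..n}" using simple uv(1) unfolding simple_graph_def by blast
  then have "u \<in> {1..n}" "v \<in> {1..n}" by auto
  then obtain B1 B2 where B12: "B1 \<in> C" "u \<in> B1" "B2 \<in> C" "v \<in> B2"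
    using partition_onD1[OF part] by blast
  obtain B' where "B' \<in> C'" "B1 \<subseteq> B'" using C'(1) B12(1) by (auto simp: refines_def)
  then have "B1 \<subseteq> B" using disj'[of B' B u] B B12(2) uv(2) by blast
  then have neq: "B1 \<noteq> B2" using B12(4) uv(3) by blast
  let ?D = "insert (B1 \<union> B2) (C - {B1, B2})"
  note merge = clustering_merge[OF C B12(1,3) neq uv(1) B12(2,4)]
  have "\<not> refines {1..n} C' ?D"
  proof
    assume ref: "refines {1..n} C' ?D"
    obtain Y1 Y2 X where Y: "Y1 \<in> C" "Y2 \<in> C" "Y1 \<noteq> Y2" "X \<in> C'" "Y1 \<subseteq> X" "Y2 \<subseteq> X"
      using refines_neq_obtains[OF C'(1,2)] .
    obtain Z where Z: "Z \<in> ?D" "X \<subseteq> Z" using ref Y(4) by (auto simp: refines_def)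
    obtain y1 y2 where y: "y1 \<in> Y1" "y2 \<in> Y2"
      using Y(1,2) partition_onD3[OF part] by (metis ex_in_conv)
    have "y1 \<in> Z" "y2 \<in> Z" using y Y Z by auto
    then have "Z \<notin> C" using disj[of Y1 Z y1] disj[of Y2 Z y2] Y y by blast
    then have "Z = B1 \<union> B2" using Z(1) by blast
    then have "Y1 \<in> {B1, B2}" "Y2 \<in> {B1, B2}"
      using \<open>y1 \<in> Z\<close> \<open>y2 \<in> Z\<close> disj y Y B12 by blast+
    then have "u \<in> X" "v \<in> X" using Y B12 by auto
    then show False using disj'[of X B u] Y(4) B uv by blast
  qed
  then show ?thesis using that merge by blast
qed

lemma partial_order_flats: "partial_order (flats n E)"
proof
  fix C D F assume "C \<sqsubseteq>\<^bsub>flats n E\<^esub> D" "D \<sqsubseteq>\<^bsub>flats n E\<^esub> F"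
  then show "C \<sqsubseteq>\<^bsub>flats n E\<^esub> F" by (simp add: flats_def) (rule refines_trans)
qed (auto simp: flats_def clustering_def refines_refl dest: refines_asym)

lemma finite_flats: "finite (carrier (flats n E))"
  by (rule finite_subset[OF _ finitely_many_partition_on[of "{1..n}"]])
    (auto simp: flats_def clustering_def)

text \<open>The maximum is attained at the clustering with the single block \<open>[n]\<close>.\<close>

lemma flats_rank_connected:
  assumes "simple_graph n E" "graph_connected {1..n} E"
  shows "flats_rank n E = n - 1"
proof -
  have ne: "{1..n} \<noteq> {}" using assms by (auto simp: graph_connected_def)
  show ?thesis
    unfolding flats_rank_def
  proof (rule Max_eqI)
    show "finite (cluster_rank n ` carrier (flats n E))" using finite_flats by simp
    fix r assume "r \<in> cluster_rank n ` carrier (flats n E)"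
    then obtain C where C: "clustering n E C" "r = n - card C"
      by (auto simp: flats_def cluster_rank_def)
    have "partition_on {1..n} C" using C(1) by (simp add: clustering_def)
    then have "finite C" "C \<noteq> {}" using ne finite_elements[of "{1..n}" C] by (auto simp: partition_on_def)
    then have "card C \<ge> 1" by (simp add: Suc_le_eq card_gt_0_iff)
    then show "r \<le> n - 1" using C(2) by simp
  next
    have "induced_edges E {1..n} = E"
      using assms(1) by (auto simp: induced_edges_def simple_graph_def)
    then have "graph_connected {1..n} (induced_edges E {1..n})" using assms(2) by simp
    then have "clustering n E {{1..n}}"
      using partition_on_space[OF ne] by (simp add: clustering_def)
    then show "n - 1 \<in> cluster_rank n ` carrier (flats n E)"
      by (auto simp: flats_def cluster_rank_def intro!: image_eqI[where x = "{{1..n}}"])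
  qed
qed


section \<open>The cluster-permutohedron inside the graphicahedron\<close>

lemma cluster_permutohedron_eq:
  "cluster_permutohedron n E = with_assignments n (flats n E) (\<lambda>C. C)"
  by (simp add: cluster_permutohedron_def with_assignments_def)

lemma graphicahedron_eq:
  "graphicahedron n E =
     with_assignments n \<lparr>carrier = Pow E, eq = (=), le = (\<subseteq>)\<rparr> (components n)"
  by (simp add: graphicahedron_def with_assignments_def)

lemma partial_order_cluster_permutohedron: "partial_order (cluster_permutohedron n E)"
  unfolding cluster_permutohedron_eq
  by (rule partial_order_with_assignments[OF partial_order_flats]) (simp add: flats_def)

lemma finite_cluster_permutohedron: "finite (carrier (cluster_permutohedron n E))"
  unfolding cluster_permutohedron_eq by (rule finite_with_assignments[OF finite_flats])

lemma partial_order_graphicahedron: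
  assumes "simple_graph n E"
  shows "partial_order (graphicahedron n E)"
  unfolding graphicahedron_eq
proof (rule partial_order_with_assignments)
  show "partial_order \<lparr>carrier = Pow E, eq = (=), le = (\<subseteq>)\<rparr>"
    by unfold_locales auto
qed (use components_mono[OF assms] in simp)

lemma finite_graphicahedron:
  assumes "simple_graph n E"
  shows "finite (carrier (graphicahedron n E))"
proof -
  have "E \<subseteq> Pow {1..n}" using assms by (auto simp: simple_graph_def)
  then have "finite E" by (rule finite_subset) simp
  then show ?thesis unfolding graphicahedron_eq by (intro finite_with_assignments) simp
qed

lemma cluster_permutohedron_simps:
  "(C, A) \<in> carrier (cluster_permutohedron n E) \<longleftrightarrow> clustering n E C \<and> A \<in> assignments n C"
  "(C', A') \<sqsubseteq>\<^bsub>cluster_permutohedron n E\<^esub> (C, A) \<longleftrightarrow>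
     refines {1..n} C' C \<and> assignment_pr n C A' = A"
  by (simp_all add: cluster_permutohedron_def flats_def)

lemma graphicahedron_simps:
  "(W, A) \<in> carrier (graphicahedron n E) \<longleftrightarrow> W \<subseteq> E \<and> A \<in> assignments n (components n W)"
  "(W', A') \<sqsubseteq>\<^bsub>graphicahedron n E\<^esub> (W, A) \<longleftrightarrow>
     W' \<subseteq> W \<and> assignment_pr n (components n W) A' = A"
  by (simp_all add: graphicahedron_def)

lemma galois_insertion_cluster_permutohedron:
  assumes "simple_graph n E"
  shows "galois_insertion (cluster_permutohedron n E) (graphicahedron n E)
    (map_prod (cluster_edges E) id) (map_prod (components n) id)"
proof -
  let ?T = "cluster_permutohedron n E" and ?S = "graphicahedron n E"
  let ?\<iota> = "map_prod (cluster_edges E) id" and ?\<pi> = "map_prod (components n) id"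
  let ?G = "\<lparr>orderA = ?S, orderB = ?T, lower = ?\<pi>, upper = ?\<iota>\<rparr>"
  have T: "partial_order ?T" by (rule partial_order_cluster_permutohedron)
  have S: "partial_order ?S" by (rule partial_order_graphicahedron[OF assms])
  have sub: "cluster_edges E C \<subseteq> E" for C by (auto simp: cluster_edges_def)
  note comp = components_cluster_edges[OF assms]
  have part: "partition_on {1..n} C" if "clustering n E C" for C
    using that by (simp add: clustering_def)
  have "cluster_edges E C' \<subseteq> cluster_edges E C \<longleftrightarrow> refines {1..n} C' C"
    if "clustering n E C'" "clustering n E C" for C' C
    using components_refine_iff[OF assms sub part[OF that(2)], of C'] comp[OF that(1)] by simp
  then have emb: "order_emb ?T ?S ?\<iota>"
    unfolding order_emb_def
    using partial_order.axioms(1)[OF T] partial_order.axioms(1)[OF S]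
    by (auto simp: cluster_permutohedron_simps graphicahedron_simps comp)
  have "galois_connection ?G"
    using S T sub components_refine_iff[OF assms _ part]
    by (intro galois_connection.intro connection.intro galois_connection_axioms.intro)
      (auto simp: cluster_permutohedron_simps graphicahedron_simps comp clustering_components[OF assms])
  then show ?thesis
    using emb galois_connection.lower_iso[of ?G] by (simp add: galois_insertion_def)
qed

lemma preserves_skeleta_cluster_permutohedron:
  assumes "simple_graph n E"
  shows "preserves_skeleta (cluster_permutohedron n E) (cl_rank n) (graphicahedron n E) (gr_conn n)
    (map_prod (cluster_edges E) id) (map_prod (components n) id)"
proof -
  have "cluster_edges E C \<subseteq> E" for C by (auto simp: cluster_edges_def)
  then show ?thesis
    by (auto simp: preserves_skeleta_def skeleton_def cluster_permutohedron_simps graphicahedron_simps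
        components_cluster_edges[OF assms] clustering_components[OF assms]
        cl_rank_def gr_conn_def cluster_rank_def)
qed

text \<open>The bound on \<open>j\<close> cannot be weakened to all \<open>j\<close>: the whole cluster-permutohedron has a greatest
  element, which for \<open>n > 1\<close> makes every point of corank one an upbeat.  Below the top rank every clustering
  in the skeleton has at least two blocks, so \<open>merge_avoiding_coarsening\<close> applies.\<close>

lemma core_poset_cluster_permutohedron_skeleton:
  assumes simple: "simple_graph n E" and graph: "graph_connected {1..n} E" and j: "j < n - 1"
  shows "core_poset (skeleton (cluster_permutohedron n E) (cl_rank n) j)"
proof -
  let ?P = "skeleton (cluster_permutohedron n E) (cl_rank n) j"
  have po: "partial_order ?P"
    unfolding skeleton_def by (rule partial_order_subset[OF partial_order_cluster_permutohedron]) auto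
  have fin: "finite (carrier ?P)" using finite_cluster_permutohedron by (simp add: skeleton_def)
  have carrier: "(C, A) \<in> carrier ?P \<longleftrightarrow>
      clustering n E C \<and> A \<in> assignments n C \<and> n - card C \<le> j" for C A
    by (auto simp: skeleton_def cluster_permutohedron_simps cl_rank_def cluster_rank_def)
  have le: "(C', A') \<sqsubseteq>\<^bsub>?P\<^esub> (C, A) \<longleftrightarrow> refines {1..n} C' C \<and> assignment_pr n C A' = A" for C' A' C A
    by (simp add: skeleton_def cluster_permutohedron_simps)
  have less: "(C', A') \<sqsubset>\<^bsub>?P\<^esub> (C, A) \<longleftrightarrow>
      refines {1..n} C' C \<and> C' \<noteq> C \<and> assignment_pr n C A' = A"
    if "(C', A') \<in> carrier ?P" for C' A' C A
    using that assignment_pr_id[of n C' A']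
    by (auto simp: partial_order.lless_eq[OF po] le carrier clustering_def)
  have "\<not> upbeat ?P x" for x
  proof
    assume "upbeat ?P x"
    moreover obtain C A where x: "x = (C, A)" by (cases x)
    ultimately obtain C' A' where xP: "(C, A) \<in> carrier ?P" and yP: "(C', A') \<in> carrier ?P"
      and xy: "(C, A) \<sqsubset>\<^bsub>?P\<^esub> (C', A')"
      and least: "\<And>z. z \<in> carrier ?P \<Longrightarrow> (C, A) \<sqsubset>\<^bsub>?P\<^esub> z \<Longrightarrow> (C', A') \<sqsubseteq>\<^bsub>?P\<^esub> z"
      unfolding upbeat_iff[OF po fin] by fast
    have ref: "refines {1..n} C C'" "C \<noteq> C'" using xy less[OF xP] by auto
    have card: "card C' > 1" "card C' < card C"
      using yP j refines_neq_card[OF _ ref] by (auto simp: carrier)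
    \<comment> \<open>Merging two blocks raises the rank by one only, which is at most the rank of \<^term>\<open>C'\<close>, so the
      point over \<^term>\<open>D\<close> stays in the skeleton.\<close>
    obtain D where D: "clustering n E D" "refines {1..n} C D" "Suc (card D) = card C"
        "\<not> refines {1..n} C' D"
      using merge_avoiding_coarsening[OF simple graph _ ref card(1)] xP by (auto simp: carrier)
    have "(D, assignment_pr n D A) \<in> carrier ?P"
      using D card(2) xP yP assignment_pr_in[OF D(2)] by (auto simp: carrier)
    moreover have "(C, A) \<sqsubset>\<^bsub>?P\<^esub> (D, assignment_pr n D A)"
      using D by (auto simp: less[OF xP])
    ultimately have "refines {1..n} C' D" using least by (auto simp: le)
    then show False using D(4) by simp
  qed
  moreover have "\<not> downbeat ?P x" for x
  proof
    assume "downbeat ?P x"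
    moreover obtain C A where x: "x = (C, A)" by (cases x)
    ultimately obtain C' A' where xP: "(C, A) \<in> carrier ?P" and yP: "(C', A') \<in> carrier ?P"
      and yx: "(C', A') \<sqsubset>\<^bsub>?P\<^esub> (C, A)"
      and greatest: "\<And>z. z \<in> carrier ?P \<Longrightarrow> z \<sqsubset>\<^bsub>?P\<^esub> (C, A) \<Longrightarrow> z \<sqsubseteq>\<^bsub>?P\<^esub> (C', A')"
      unfolding downbeat_iff[OF po fin] by fast
    have ref: "refines {1..n} C' C" "C' \<noteq> C" "assignment_pr n C A' = A"
      using yx less[OF yP] by auto
    have A': "A' \<in> assignments n C'" using yP by (simp add: carrier)
    obtain A'' where A'': "A'' \<in> assignments n C'" "A'' \<noteq> A'"
        "assignment_pr n C A'' = assignment_pr n C A'"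
      using another_assignment[OF ref(1,2) A'] .
    have zP: "(C', A'') \<in> carrier ?P" using yP A''(1) by (simp add: carrier)
    then have "(C', A'') \<sqsubseteq>\<^bsub>?P\<^esub> (C', A')"
      using greatest ref A''(3) by (simp add: less)
    then show False using A''(1,2) assignment_pr_id by (auto simp: le refines_def)
  qed
  ultimately show ?thesis using po fin by (simp add: core_poset_def)
qed

theorem proposition4:
  fixes n :: nat and E :: "nat set set"
  assumes "simple_graph n E" and "graph_connected {1..n} E"
  shows "(\<exists>\<iota> \<pi>.
            galois_insertion (cluster_permutohedron n E) (graphicahedron n E) \<iota> \<pi> \<and>
            preserves_skeleta (cluster_permutohedron n E) (cl_rank n)
              (graphicahedron n E) (gr_conn n) \<iota> \<pi>) \<and>
         (n > 1 \<longrightarrow>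
            flats_rank n E = n - 1 \<and>
            (\<forall>j < flats_rank n E.
               is_core_of (skeleton (cluster_permutohedron n E) (cl_rank n) j)
                 (skeleton (graphicahedron n E) (gr_conn n) j)))"
proof -
  note insertion = galois_insertion_cluster_permutohedron[OF assms(1)]
  note skeleta = preserves_skeleta_cluster_permutohedron[OF assms(1)]
  have "is_core_of (skeleton (cluster_permutohedron n E) (cl_rank n) j)
      (skeleton (graphicahedron n E) (gr_conn n) j)" if "j < n - 1" for j
  proof (rule galois_insertion_core[OF galois_insertion_skeleton[OF insertion skeleta]])
    show "finite (carrier (skeleton (graphicahedron n E) (gr_conn n) j))"
      using finite_graphicahedron[OF assms(1)] by (simp add: skeleton_def)
  qed (rule core_poset_cluster_permutohedron_skeleton[OF assms that])
  then show ?thesis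
    using insertion skeleta flats_rank_connected[OF assms] by auto
qed

end
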